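(* Let $L$ be an $s\times s$ GCB matrix and let $G$ be its underlying digraph. If $G$ is strongly connected, then ${\rm rank}(L)=s-1$ and $L^\top$ is a GCB matrix.
   Context: An $s\times s$ integer matrix $L$ is a GCB (generalized critical binomial) matrix if its diagonal entries are $a_{1,1},\ldots,a_{s,s}>0$, its off-diagonal entries are $-a_{i,j}$ with $a_{i,j}\in\mathbb{N}=\{0,1,\ldots\}$, each column has at least one non-zero off-diagonal entry, and there exists a vector $\mathbf{b}$ of $s$ positive integers with $L\mathbf{b}^\top=0$. The underlying digraph of an $s\times s$ real matrix $A=(a_{i,j})$ has vertex set $\{t_1,\ldots,t_s\}$ with an arc from $t_i$ to $t_j$ if and only if $a_{i,j}\neq0$ (loops allowed). A digraph is strongly connected if any two vertices can be joined by a directed path (from any vertex to any other vertex). *)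

theory Defs
  imports "HOL-Analysis.Analysis" "Graph_Theory.Graph_Theory"
begin

text \<open>
  \<open>L $ i $ j\<close> is the entry in row \<open>i\<close> and column \<open>j\<close>, so the third condition is about columns; it
  forces \<open>CARD('n) \<ge> 2\<close>. Off-diagonal entries \<open>- a\<close> with \<open>a\<close> a natural number are the nonpositive ones.
\<close>

definition gcb_matrix :: "int ^ 'n ^ 'n::finite \<Rightarrow> bool" where
  "gcb_matrix L \<longleftrightarrow>
     (\<forall>i. L $ i $ i > 0) \<and>
     (\<forall>i j. i \<noteq> j \<longrightarrow> L $ i $ j \<le> 0) \<and>
     (\<forall>j. \<exists>i. i \<noteq> j \<and> L $ i $ j \<noteq> 0) \<and>
     (\<exists>b :: int ^ 'n. (\<forall>i. b $ i > 0) \<and> L *v b = 0)"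

definition underlying_digraph :: "real ^ 'n ^ 'n::finite \<Rightarrow> 'n pair_pre_digraph" where
  "underlying_digraph A = \<lparr> pverts = UNIV, parcs = {(i, j). A $ i $ j \<noteq> 0} \<rparr>"

end

theory Submission
  imports Defs
begin

text \<open>
  If \<open>L x = 0\<close> and \<open>m\<close> is the least ratio \<open>x\<^sub>i / b\<^sub>i\<close>, then \<open>x - m b\<close> is a nonnegative kernel
  vector with a zero entry; by the sign pattern of \<open>L\<close> zero entries propagate along arcs, so
  strong connectivity gives \<open>x = m b\<close> and the kernel is a line. For the transpose, take a nonzero
  integer vector \<open>c\<close> with \<open>c L = 0\<close>. The triangle inequality gives \<open>|c| L \<le> 0\<close> entrywise, and
  pairing with the positive vector \<open>b\<close> forces \<open>|c| L = 0\<close>. Nonzero entries of \<open>|c|\<close> propagate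
  along arcs, so \<open>|c|\<close> is positive.
\<close>

text \<open>Induction along a directed path from \<open>i\<close> to \<open>j\<close>. This is the
  only form in which strong connectivity is used; \<open>P\<close> will be the vanishing, or the
  non-vanishing, of an entry of a kernel vector.\<close>

lemma strongly_connected_induct:
  assumes "strongly_connected (with_proj (underlying_digraph A))"
    and step: "\<And>i j. P i \<Longrightarrow> A $ i $ j \<noteq> 0 \<Longrightarrow> P j"
    and "P i"
  shows "P j"
proof -
  have "(i, j) \<in> rtrancl_on UNIV {(i, j). A $ i $ j \<noteq> 0}"
    using assms(1) by (auto simp: strongly_connected_def reachable_def underlying_digraph_def)
  then show ?thesis
    by (induction rule: rtrancl_on_induct) (use \<open>P i\<close> step in auto)
qed

lemma sum_nonpos_0:
  fixes f :: "'a \<Rightarrow> 'b::ordered_ab_group_add"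
  assumes "finite A" "\<And>i. i \<in> A \<Longrightarrow> f i \<le> 0" "sum f A = 0" "i \<in> A"
  shows "f i = 0"
  using sum_nonneg_0[of A "\<lambda>i. - f i" i] assms by (simp add: sum_negf)

lemma nonneg_kernel_vector_eq_0:
  fixes A :: "real ^ 'n ^ 'n::finite"
  assumes off_diag: "\<And>i j. i \<noteq> j \<Longrightarrow> A $ i $ j \<le> 0"
    and conn: "strongly_connected (with_proj (underlying_digraph A))"
    and ker: "A *v y = 0" and nonneg: "\<And>i. y $ i \<ge> 0" and zero: "y $ k = 0"
  shows "y = 0"
proof -
  have "y $ j = 0" if "y $ i = 0" "A $ i $ j \<noteq> 0" for i j
  proof -
    have "(\<Sum>l\<in>UNIV. A $ i $ l * y $ l) = 0"
      using ker by (simp add: vec_eq_iff matrix_vector_mult_def)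
    \<comment> \<open>The diagonal term of row \<open>i\<close> vanishes because
      \<open>y $ i = 0\<close>, and the others are nonpositive by the signs of \<open>A\<close> and
      \<open>y\<close>. As the row sums to zero, every term is zero.\<close>
    moreover have "A $ i $ l * y $ l \<le> 0" for l
      using that(1) off_diag[of i l] nonneg[of l] by (cases "i = l") (auto intro: mult_nonpos_nonneg)
    ultimately have "A $ i $ j * y $ j = 0"
      by (intro sum_nonpos_0[of UNIV "\<lambda>l. A $ i $ l * y $ l" j]) simp_all
    then show ?thesis using that(2) by simp
  qed
  then have "y $ j = 0" for j
    using strongly_connected_induct[OF conn, of "\<lambda>i. y $ i = 0"] zero by blast
  then show ?thesis by (simp add: vec_eq_iff)
qed

lemma kernel_eq_span_positive_vector:
  fixes A :: "real ^ 'n ^ 'n::finite"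
  assumes off_diag: "\<And>i j. i \<noteq> j \<Longrightarrow> A $ i $ j \<le> 0"
    and conn: "strongly_connected (with_proj (underlying_digraph A))"
    and pos: "\<And>i. b $ i > 0" and Ab: "A *v b = 0"
  shows "{x. A *v x = 0} = span {b}"
proof (intro equalityI subsetI)
  fix x assume "x \<in> {x. A *v x = 0}"
  then have Ax: "A *v x = 0" by simp
  \<comment> \<open>\<open>m\<close> is the largest scalar for which
    \<open>x - m *\<^sub>R b\<close> is still nonnegative; an index \<open>k\<close> attaining the
    minimum supplies the zero entry.\<close>
  define m where "m = Min (range (\<lambda>i. x $ i / b $ i))"
  have "m \<in> range (\<lambda>i. x $ i / b $ i)"
    unfolding m_def by (intro Min_in) auto
  then obtain k where k: "m = x $ k / b $ k" by blast
  have "m \<le> x $ i / b $ i" for i unfolding m_def by simp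
  then have "(x - m *\<^sub>R b) $ i \<ge> 0" for i
    using pos[of i] by (simp flip: pos_le_divide_eq)
  moreover have "(x - m *\<^sub>R b) $ k = 0"
    using k pos[of k] by simp
  moreover have "A *v (x - m *\<^sub>R b) = 0"
    using Ax Ab by (simp add: matrix_vector_mult_diff_distrib matrix_vector_mult_scaleR)
  ultimately have "x - m *\<^sub>R b = 0"
    using nonneg_kernel_vector_eq_0[OF off_diag conn] by blast
  then show "x \<in> span {b}" by (auto simp: span_singleton)
qed (use Ab in \<open>auto simp: span_singleton matrix_vector_mult_scaleR\<close>)

text \<open>The kernel is the orthogonal complement of the row space, so the two dimensions add up
  to that of the whole space.\<close>

lemma rank_plus_dim_kernel:
  fixes A :: "real ^ 'n ^ 'm"
  shows "rank A + dim {x. A *v x = 0} = CARD('n)"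
proof -
  have "{x. A *v x = 0} = {y \<in> UNIV. \<forall>x \<in> span (rows A). orthogonal x y}"
  proof (intro equalityI subsetI)
    fix x assume "x \<in> {x. A *v x = 0}"
    then show "x \<in> {y \<in> UNIV. \<forall>x \<in> span (rows A). orthogonal x y}"
      using orthogonal_nullspace_rowspace[of A x] by (auto simp: orthogonal_commute)
  next
    fix x assume "x \<in> {y \<in> UNIV. \<forall>x \<in> span (rows A). orthogonal x y}"
    then have "orthogonal (A $ i) x" for i
      by (auto simp: rows_def row_def intro!: span_base)
    then show "x \<in> {x. A *v x = 0}"
      by (auto simp: vec_eq_iff matrix_vector_mul_component orthogonal_def)
  qed
  then show ?thesis
    using dim_subspace_orthogonal_to_vectors[of "span (rows A)" "UNIV :: (real ^ 'n) set"]
    by (simp add: row_rank_def)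
qed

text \<open>Used to clear the denominators of a rational kernel vector. Each inserted rational
  multiplies \<open>N\<close> by its own denominator.\<close>

lemma exists_pos_common_denominator:
  assumes "finite S"
  shows "\<exists>N::int. N > 0 \<and> (\<forall>q \<in> S. of_int N * q \<in> (\<int> :: rat set))"
  using assms
proof induction
  case empty
  show ?case by (auto intro: exI[of _ 1])
next
  case (insert q S)
  then obtain N :: int where N: "N > 0" "\<forall>r \<in> S. of_int N * r \<in> (\<int> :: rat set)" by blast
  obtain a d where q: "q = Fract a d" and d: "d > 0" by (cases q) auto
  have "of_int (N * d) * r \<in> \<int>" if "r \<in> insert q S" for r
  proof (cases "r = q")
    case True
    have "of_int (N * d) * q = of_int (N * a)"
      using d by (simp add: q Fract_of_int_quotient)
    then show ?thesis using True by (metis Ints_of_int)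
  next
    case False
    have "of_int (N * d) * r = of_int d * (of_int N * r)"
      by (simp only: of_int_mult mult_ac)
    also have "\<dots> \<in> \<int>" using N(2) that False by (intro Ints_mult[OF Ints_of_int, of "of_int N * r" d]) simp
    finally show ?thesis .
  qed
  then show ?case using N(1) d by (intro exI[of _ "N * d"]) auto
qed

text \<open>A square matrix over a field is singular exactly when its transpose is. The field here
  is that of the rationals, so that a kernel vector can be scaled to an integral one.\<close>

lemma int_matrix_transpose_kernel_nonzero:
  fixes A :: "int ^ 'n ^ 'n::finite"
  assumes "A *v b = 0" "b \<noteq> 0"
  shows "\<exists>c. c \<noteq> 0 \<and> transpose A *v c = 0"
proof -
  define B where "B = map_matrix rat_of_int A"
  have "B *v (\<chi> i. rat_of_int (b $ i)) = (\<chi> i. rat_of_int ((A *v b) $ i))"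
    by (simp add: B_def vec_eq_iff matrix_vector_mult_def)
  then have "B *v (\<chi> i. rat_of_int (b $ i)) = 0"
    using assms(1) by (simp add: vec_eq_iff)
  moreover have "(\<chi> i. rat_of_int (b $ i)) \<noteq> 0"
    using assms(2) by (simp add: vec_eq_iff)
  ultimately have "\<not> invertible B"
    unfolding invertible_left_inverse matrix_left_invertible_ker by blast
  then have "\<not> invertible (transpose B)"
    by (metis invertible_left_inverse invertible_right_inverse left_invertible_transpose)
  then obtain q where q: "transpose B *v q = 0" "q \<noteq> 0"
    unfolding invertible_left_inverse matrix_left_invertible_ker by blast
  obtain N :: int where N: "N > 0" "\<And>i. of_int N * q $ i \<in> \<int>"
    using exists_pos_common_denominator[of "range (($) q)"] by auto
  \<comment> \<open>The floor changes only the type: by the choice of \<open>N\<close> its argument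
    is already an integer.\<close>
  define c where "c = (\<chi> i. \<lfloor>of_int N * q $ i\<rfloor>)"
  have c: "rat_of_int (c $ i) = of_int N * q $ i" for i
    using N(2)[of i] by (simp add: c_def)
  have "rat_of_int ((transpose A *v c) $ i) = of_int N * (transpose B *v q) $ i" for i
    by (simp add: matrix_vector_mult_def transpose_def c B_def sum_distrib_left mult_ac)
  then have "transpose A *v c = 0"
    using q(1) by (simp add: vec_eq_iff)
  moreover have "c \<noteq> 0"
    using q(2) N(1) c by (auto simp: vec_eq_iff) (metis c mult_eq_0_iff of_int_0_eq_iff less_irrefl)
  ultimately show ?thesis by blast
qed

lemma abs_in_transpose_kernel:
  fixes A :: "int ^ 'n ^ 'n::finite"
  assumes diag: "\<And>i. A $ i $ i \<ge> 0"
    and off_diag: "\<And>i j. i \<noteq> j \<Longrightarrow> A $ i $ j \<le> 0"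
    and pos: "\<And>i. b $ i > 0" and Ab: "A *v b = 0"
    and c: "transpose A *v c = 0"
  shows "transpose A *v (\<chi> i. \<bar>c $ i\<bar>) = 0"
proof -
  define e where "e j = (\<Sum>i\<in>UNIV. A $ i $ j * \<bar>c $ i\<bar>)" for j
  have e_nonpos: "e j \<le> 0" for j
  proof -
    have "(\<Sum>i\<in>UNIV. A $ i $ j * c $ i) = 0"
      using c by (simp add: vec_eq_iff matrix_vector_mult_def transpose_def)
    \<comment> \<open>With the diagonal term isolated, taking absolute values on both sides and
      using the sign pattern of column \<open>j\<close> turns the triangle inequality into
      \<open>e j \<le> 0\<close>.\<close>
    then have "A $ j $ j * c $ j = - (\<Sum>i\<in>UNIV - {j}. A $ i $ j * c $ i)"
      by (simp add: sum.remove[of UNIV j])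
    then have "\<bar>A $ j $ j * c $ j\<bar> \<le> (\<Sum>i\<in>UNIV - {j}. \<bar>A $ i $ j * c $ i\<bar>)"
      by (simp add: sum_abs)
    also have "\<dots> = - (\<Sum>i\<in>UNIV - {j}. A $ i $ j * \<bar>c $ i\<bar>)"
      unfolding sum_negf[symmetric]
      by (intro sum.cong refl) (use off_diag in \<open>auto simp: abs_mult abs_of_nonpos\<close>)
    finally show ?thesis
      using diag[of j] by (simp add: e_def sum.remove[of UNIV j] abs_mult)
  qed
  \<comment> \<open>Associativity of the product of the row \<open>|c|\<close>, the matrix
    \<open>A\<close> and the column \<open>b\<close>, obtained by exchanging the two sums.\<close>
  have "(\<Sum>j\<in>UNIV. e j * b $ j) = (\<Sum>i\<in>UNIV. \<bar>c $ i\<bar> * (A *v b) $ i)"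
    unfolding e_def sum_distrib_right
    by (subst sum.swap) (simp add: matrix_vector_mult_def sum_distrib_left mult_ac)
  also have "\<dots> = 0" using Ab by simp
  finally have "(\<Sum>j\<in>UNIV. e j * b $ j) = 0" .
  moreover have "e j * b $ j \<le> 0" for j
    using e_nonpos[of j] pos[of j] by (intro mult_nonpos_nonneg) auto
  ultimately have e_b: "e j * b $ j = 0" for j
    by (intro sum_nonpos_0[of UNIV "\<lambda>j. e j * b $ j" j]) simp_all
  have "e j = 0" for j
    using e_b[of j] pos[of j] by simp
  then show ?thesis
    by (simp add: e_def vec_eq_iff matrix_vector_mult_def transpose_def)
qed

text \<open>A zero entry at \<open>j\<close> makes all terms of column \<open>j\<close> nonpositive,
  hence zero, so zeros spread backwards along the arcs into \<open>j\<close>. Contrapositively,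
  nonzero entries spread forwards and reach every vertex.\<close>

lemma nonneg_transpose_kernel_vector_pos:
  fixes A :: "int ^ 'n ^ 'n::finite"
  assumes off_diag: "\<And>i j. i \<noteq> j \<Longrightarrow> A $ i $ j \<le> 0"
    and conn: "strongly_connected (with_proj (underlying_digraph (map_matrix real_of_int A)))"
    and ker: "transpose A *v d = 0" and nonneg: "\<And>i. d $ i \<ge> 0" and "d \<noteq> 0"
  shows "d $ k > 0"
proof -
  have step: "d $ j \<noteq> 0" if "d $ i \<noteq> 0" "map_matrix real_of_int A $ i $ j \<noteq> 0" for i j
  proof
    assume j: "d $ j = 0"
    have "(\<Sum>l\<in>UNIV. A $ l $ j * d $ l) = 0"
      using ker by (simp add: vec_eq_iff matrix_vector_mult_def transpose_def)
    moreover have "A $ l $ j * d $ l \<le> 0" for l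
      using j off_diag[of l j] nonneg[of l] by (cases "l = j") (auto intro: mult_nonpos_nonneg)
    ultimately have "A $ i $ j * d $ i = 0"
      by (intro sum_nonpos_0[of UNIV "\<lambda>l. A $ l $ j * d $ l" i]) simp_all
    then show False using that by simp
  qed
  obtain i where "d $ i \<noteq> 0" using \<open>d \<noteq> 0\<close> by (auto simp: vec_eq_iff)
  then have "d $ k \<noteq> 0"
    using strongly_connected_induct[OF conn, of "\<lambda>i. d $ i \<noteq> 0"] step by blast
  then show ?thesis using nonneg[of k] by simp
qed

theorem theorem7p5:
  fixes L :: "int ^ 'n ^ 'n::finite"
  assumes "gcb_matrix L"
    and "strongly_connected (with_proj (underlying_digraph (map_matrix real_of_int L)))"
  shows "rank (map_matrix real_of_int L) = CARD('n) - 1 \<and> gcb_matrix (transpose L)"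
proof
  obtain b where pos: "\<And>i. b $ i > 0" and Lb: "L *v b = 0"
    using assms(1) by (auto simp: gcb_matrix_def)
  have diag: "L $ i $ i > 0" and off_diag: "i \<noteq> j \<Longrightarrow> L $ i $ j \<le> 0" for i j
    using assms(1) by (auto simp: gcb_matrix_def)
  have Lb_row: "(\<Sum>j\<in>UNIV. L $ i $ j * b $ j) = 0" for i
    using Lb by (simp add: vec_eq_iff matrix_vector_mult_def)
  have b: "b \<noteq> 0" using pos by (metis less_irrefl zero_index)

  define v :: "real ^ 'n" where "v = (\<chi> i. real_of_int (b $ i))"
  have "(map_matrix real_of_int L *v v) $ i = real_of_int (\<Sum>j\<in>UNIV. L $ i $ j * b $ j)" for i
    by (simp add: v_def matrix_vector_mult_def)
  then have "map_matrix real_of_int L *v v = 0"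
    by (simp add: Lb_row vec_eq_iff)
  then have "{x. map_matrix real_of_int L *v x = 0} = span {v}"
    by (intro kernel_eq_span_positive_vector assms(2)) (auto simp: v_def pos off_diag)
  moreover have "v \<noteq> 0" using b by (simp add: v_def vec_eq_iff)
  ultimately have "dim {x. map_matrix real_of_int L *v x = 0} = 1"
    by (simp add: dim_insert)
  \<comment> \<open>The subtraction of natural numbers does not truncate, since
    \<open>CARD('n)\<close> is the rank plus one.\<close>
  then show "rank (map_matrix real_of_int L) = CARD('n) - 1"
    using rank_plus_dim_kernel[of "map_matrix real_of_int L"] by linarith

  obtain c where c: "c \<noteq> 0" "transpose L *v c = 0"
    using int_matrix_transpose_kernel_nonzero[OF Lb b] by blast
  define d where "d = (\<chi> i. \<bar>c $ i\<bar>)"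
  have ker: "transpose L *v d = 0"
    unfolding d_def
    by (intro abs_in_transpose_kernel[OF _ off_diag pos Lb c(2)]) (use diag in \<open>auto intro: less_imp_le\<close>)
  have "d $ i > 0" for i
    by (intro nonneg_transpose_kernel_vector_pos[OF off_diag assms(2) ker])
      (use c(1) in \<open>auto simp: d_def vec_eq_iff\<close>)
  \<comment> \<open>The column condition for the transpose is a condition on the rows of
    \<open>L\<close>. If row \<open>i\<close> had only its diagonal entry, \<open>L *v b = 0\<close>
    would force the positive number \<open>L $ i $ i * b $ i\<close> to be zero.\<close>
  moreover have "\<exists>j. j \<noteq> i \<and> L $ i $ j \<noteq> 0" for i
  proof (rule ccontr)
    assume "\<nexists>j. j \<noteq> i \<and> L $ i $ j \<noteq> 0"
    then have "(\<Sum>j\<in>UNIV. L $ i $ j * b $ j) = L $ i $ i * b $ i"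
      by (subst sum.remove[of UNIV i]) (auto intro!: sum.neutral)
    then show False
      using Lb_row[of i] diag[of i] pos[of i] by simp
  qed
  ultimately show "gcb_matrix (transpose L)"
    using diag off_diag ker by (auto simp: gcb_matrix_def transpose_def)
qed

end
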